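(* Let $G=(V,E)$ be a connected simple graph with a fixed number $n\ge 2$ of vertices and edges $E=\{e_1,\dots,e_m\}$, and let $M>0$. Then the Kirchhoff index $Kf_G(\mathbf x)$, as a function of the edge weight vector $\mathbf x$, is strongly convex on the set $\{\mathbf x\in\mathbb{R}^m: 0<x_k\le M \text{ for all } k\}$ of edge weight vectors with bounded weights: there exists a constant $\alpha>0$ such that the smallest eigenvalue of the Hessian matrix $\nabla^2 Kf_G(\mathbf x)$ is at least $\alpha$ for every $\mathbf x$ in this set.
   Context: For positive edge weights $\mathbf x$ (weight $x_k$ on edge $e_k$), the Laplacian is $L=D-A$ where $A_{st}=x_k$ if $\{s,t\}=e_k\in E$ and $0$ otherwise, and $D$ is the diagonal matrix of row sums of $A$; $L^\dagger$ is its Moore–Penrose inverse. The resistance distance is $R_{ij}(\mathbf x)=(L^\dagger)_{ii}+(L^\dagger)_{jj}-2(L^\dagger)_{ij}$ and the Kirchhoff index is $Kf_G(\mathbf x)=\sum_{i<j}R_{ij}(\mathbf x)$. A twice continuously differentiable function is strongly convex (on a convex set) if there is $\alpha>0$ such that the smallest eigenvalue of its Hessian matrix is at least $\alpha$ at every point of the set. *)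

theory Defs
  imports "HOL-Analysis.Analysis"
begin

text \<open>A graph has all of the finite type \<open>'v\<close> as its vertex set; its edges are unordered pairs.\<close>

definition simple_graph :: "'v::finite set set \<Rightarrow> bool" where
  "simple_graph E \<longleftrightarrow> (\<forall>p\<in>E. card p = 2)"

definition connected_graph :: "'v::finite set set \<Rightarrow> bool" where
  "connected_graph E \<longleftrightarrow> (\<forall>s t. (s, t) \<in> {(a, b). {a, b} \<in> E}\<^sup>*)"

text \<open>The map \<open>e\<close> enumerates the edges, and \<open>x $ k\<close> is the weight of the edge \<open>e k\<close>.\<close>

definition adjacency_matrix :: "('m::finite \<Rightarrow> 'v::finite set) \<Rightarrow> real ^ 'm \<Rightarrow> real ^ 'v ^ 'v" where
  "adjacency_matrix e x =
     (\<chi> s t. if \<exists>k. {s, t} = e k then x $ (THE k. {s, t} = e k) else 0)"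

definition degree_matrix :: "('m::finite \<Rightarrow> 'v::finite set) \<Rightarrow> real ^ 'm \<Rightarrow> real ^ 'v ^ 'v" where
  "degree_matrix e x =
     (\<chi> s t. if s = t then (\<Sum>u\<in>UNIV. adjacency_matrix e x $ s $ u) else 0)"

definition laplacian :: "('m::finite \<Rightarrow> 'v::finite set) \<Rightarrow> real ^ 'm \<Rightarrow> real ^ 'v ^ 'v" where
  "laplacian e x = degree_matrix e x - adjacency_matrix e x"

text \<open>The four Penrose equations, which have exactly one solution for every real matrix.\<close>

definition is_moore_penrose_inverse :: "real ^ 'n ^ 'm \<Rightarrow> real ^ 'm ^ 'n \<Rightarrow> bool" where
  "is_moore_penrose_inverse A X \<longleftrightarrow>
     A ** X ** A = A \<and> X ** A ** X = X \<and>
     transpose (A ** X) = A ** X \<and> transpose (X ** A) = X ** A"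

definition moore_penrose_inverse :: "real ^ 'n ^ 'm \<Rightarrow> real ^ 'm ^ 'n" where
  "moore_penrose_inverse A = (THE X. is_moore_penrose_inverse A X)"

definition resistance_distance ::
    "('m::finite \<Rightarrow> 'v::finite set) \<Rightarrow> real ^ 'm \<Rightarrow> 'v \<Rightarrow> 'v \<Rightarrow> real" where
  "resistance_distance e x i j =
     (let P = moore_penrose_inverse (laplacian e x) in P $ i $ i + P $ j $ j - 2 * P $ i $ j)"

text \<open>The linear order on \<open>'v\<close> serves only to let each unordered pair of vertices contribute
  once to the sum.\<close>

definition kirchhoff_index ::
    "('m::finite \<Rightarrow> 'v::{finite,linorder} set) \<Rightarrow> real ^ 'm \<Rightarrow> real" where
  "kirchhoff_index e x = (\<Sum>(i, j)\<in>{(i, j). i < j}. resistance_distance e x i j)"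

definition partial_deriv :: "'m::finite \<Rightarrow> (real ^ 'm \<Rightarrow> real) \<Rightarrow> real ^ 'm \<Rightarrow> real" where
  "partial_deriv k f x = deriv (\<lambda>t. f (x + t *\<^sub>R axis k 1)) 0"

definition hessian :: "(real ^ 'm::finite \<Rightarrow> real) \<Rightarrow> real ^ 'm \<Rightarrow> real ^ 'm ^ 'm" where
  "hessian f x = (\<chi> k l. partial_deriv k (partial_deriv l f) x)"

text \<open>Intended for open sets. Differentiability is required separately because
  \<^const>\<open>deriv\<close> is total.\<close>

definition twice_continuously_differentiable_on ::
    "(real ^ 'm::finite \<Rightarrow> real) \<Rightarrow> (real ^ 'm) set \<Rightarrow> bool" where
  "twice_continuously_differentiable_on f U \<longleftrightarrow>
     (\<forall>x\<in>U. f differentiable (at x)) \<and>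
     (\<forall>k. \<forall>x\<in>U. partial_deriv k f differentiable (at x)) \<and>
     (\<forall>k l. continuous_on U (partial_deriv k (partial_deriv l f)))"

definition eigenvalue :: "real ^ 'n ^ 'n \<Rightarrow> real \<Rightarrow> bool" where
  "eigenvalue A c \<longleftrightarrow> (\<exists>v. v \<noteq> 0 \<and> A *v v = c *\<^sub>R v)"

text \<open>Meaningful only if \<open>A\<close> has a real eigenvalue, as every symmetric matrix does;
  \<^const>\<open>Min\<close> of the empty set is unspecified.\<close>

definition smallest_eigenvalue :: "real ^ 'n ^ 'n \<Rightarrow> real" where
  "smallest_eigenvalue A = Min {c. eigenvalue A c}"

text \<open>The set \<open>S\<close> need not be open, so the derivatives are taken in an open set containing it.\<close>

definition strongly_convex_on :: "(real ^ 'm::finite) set \<Rightarrow> (real ^ 'm \<Rightarrow> real) \<Rightarrow> bool" where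
  "strongly_convex_on S f \<longleftrightarrow>
     convex S \<and>
     (\<exists>U. open U \<and> S \<subseteq> U \<and> twice_continuously_differentiable_on f U) \<and>
     (\<exists>\<alpha>>0. \<forall>x\<in>S. smallest_eigenvalue (hessian f x) \<ge> \<alpha>)"

end

theory Submission
  imports Defs
begin

text \<open>Let \<open>J\<close> be the orthogonal projection onto the constant vectors and \<open>n\<close> the number of
  vertices. The matrix \<open>K = L + J\<close> is positive definite with inverse \<open>N = L\<^sup>\<dagger> + J\<close>, so
  \<open>Kf = n (trace N - 1)\<close>. As \<open>K\<close> is affine in the weights with \<open>L = (\<Sum>k. x k * b k * b k\<^sup>T)\<close>,
  where \<open>b k\<close> are the incidence vectors, the Hessian form of \<open>Kf\<close> at \<open>v\<close> is
  \<open>2 n trace (N B N B N)\<close> with \<open>B = (\<Sum>k. v k * b k * b k\<^sup>T)\<close>. Bounded weights bound the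
  eigenvalues of \<open>K\<close> by some \<open>\<Lambda>\<close>, so those of \<open>N\<close> are at least \<open>1 / \<Lambda>\<close> and the form is at
  least \<open>2 n / \<Lambda>\<^sup>3\<close> times the squared Frobenius norm of \<open>B\<close>, whose off-diagonal entries
  include every \<open>- v k\<close>.\<close>

section \<open>Differentiation tools\<close>

text \<open>Where \<open>u\<close> vanishes, continuity of \<open>\<phi>\<close> is enough for a
  product rule: the remainder is that of \<open>u\<close> times \<open>\<phi> y\<close>, plus
  \<open>u' (y - x)\<close> times \<open>\<phi> y - \<phi> x\<close>, and both are of smaller order
  than \<open>norm (y - x)\<close>.\<close>

lemma has_derivative_vanishing_scaleR:
  fixes u :: "'a::real_normed_vector \<Rightarrow> real" and \<phi> :: "'a \<Rightarrow> 'b::real_normed_vector"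
  assumes u: "(u has_derivative u') (at x)" and ux: "u x = 0" and \<phi>: "isCont \<phi> x"
  shows "((\<lambda>y. u y *\<^sub>R \<phi> y) has_derivative (\<lambda>h. u' h *\<^sub>R \<phi> x)) (at x)"
proof -
  have bl: "bounded_linear u'" using u by (rule has_derivative_bounded_linear)
  obtain C where C: "\<And>h. norm (u' h) \<le> norm h * C"
    using bounded_linear.bounded[OF bl] by blast
  have lim: "((\<lambda>y. norm (u y - u x - u' (y - x)) / norm (y - x)) \<longlongrightarrow> 0) (at x)"
    using u by (simp add: has_derivative_iff_norm)
  have \<phi>': "(\<phi> \<longlongrightarrow> \<phi> x) (at x)" using \<phi> by (simp add: isCont_def)
  let ?H = "\<lambda>y. norm (u y - u x - u' (y - x)) / norm (y - x) * norm (\<phi> y) + C * norm (\<phi> y - \<phi> x)"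
  have "(?H \<longlongrightarrow> 0 * norm (\<phi> x) + C * norm (\<phi> x - \<phi> x)) (at x)"
    by (intro tendsto_intros lim \<phi>')
  then have H: "(?H \<longlongrightarrow> 0) (at x)" by simp
  show ?thesis
  proof (rule has_derivativeI_sandwich[of 1])
    show "bounded_linear (\<lambda>h. u' h *\<^sub>R \<phi> x)"
      using bl by (rule bounded_linear_scaleR_const)
    fix y assume "y \<noteq> x"
    then have pos: "norm (y - x) > 0" by simp
    have "u y *\<^sub>R \<phi> y - u x *\<^sub>R \<phi> x - u' (y - x) *\<^sub>R \<phi> x
        = (u y - u x - u' (y - x)) *\<^sub>R \<phi> y + u' (y - x) *\<^sub>R (\<phi> y - \<phi> x)"
      using ux by (simp add: algebra_simps)
    then have "norm (u y *\<^sub>R \<phi> y - u x *\<^sub>R \<phi> x - u' (y - x) *\<^sub>R \<phi> x)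
        \<le> norm (u y - u x - u' (y - x)) * norm (\<phi> y) + norm (u' (y - x)) * norm (\<phi> y - \<phi> x)"
      by (metis norm_scaleR norm_triangle_ineq real_norm_def)
    also have "\<dots> \<le> norm (u y - u x - u' (y - x)) * norm (\<phi> y) + (norm (y - x) * C) * norm (\<phi> y - \<phi> x)"
      by (intro add_left_mono mult_right_mono C) simp
    finally have "norm (u y *\<^sub>R \<phi> y - u x *\<^sub>R \<phi> x - u' (y - x) *\<^sub>R \<phi> x) / norm (y - x)
       \<le> (norm (u y - u x - u' (y - x)) * norm (\<phi> y) + (norm (y - x) * C) * norm (\<phi> y - \<phi> x)) / norm (y - x)"
      using pos by (intro divide_right_mono) auto
    also have "\<dots> = ?H y" using pos by (simp add: field_simps)
    finally show "norm (u y *\<^sub>R \<phi> y - u x *\<^sub>R \<phi> x - u' (y - x) *\<^sub>R \<phi> x) / norm (y - x) \<le> ?H y" .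
  qed (use H in auto)
qed

lemma partial_deriv_eq:
  assumes "(f has_derivative F) (at x)"
  shows "partial_deriv k f x = F (axis k 1)"
proof -
  interpret F: bounded_linear F using assms by (rule has_derivative_bounded_linear)
  have 1: "((\<lambda>t::real. x + t *\<^sub>R axis k (1::real)) has_derivative (\<lambda>t. t *\<^sub>R axis k 1)) (at 0)"
    by (auto intro!: derivative_eq_intros)
  have "((\<lambda>t. f (x + t *\<^sub>R axis k 1)) has_derivative (\<lambda>t. F (t *\<^sub>R axis k 1))) (at 0)"
    using has_derivative_compose[OF 1, of f F] assms by simp
  then have "((\<lambda>t. f (x + t *\<^sub>R axis k 1)) has_real_derivative F (axis k 1)) (at 0)"
    by (simp add: has_field_derivative_def F.scaleR mult.commute[of _ "F _"])
  then show ?thesis unfolding partial_deriv_def by (rule DERIV_imp_deriv)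
qed

section \<open>Positive semidefinite forms and eigenvalues of symmetric matrices\<close>

text \<open>The form at \<open>s *\<^sub>R x + t *\<^sub>R y\<close> is a nonnegative quadratic in
  \<open>s\<close> and \<open>t\<close>, and suitable values give the discriminant bound.\<close>

lemma psd_Cauchy_Schwarz:
  fixes A :: "real^'n^'n"
  assumes sym: "\<And>x y. x \<bullet> (A *v y) = (A *v x) \<bullet> y"
    and psd: "\<And>x. 0 \<le> x \<bullet> (A *v x)"
  shows "(x \<bullet> (A *v y))\<^sup>2 \<le> (x \<bullet> (A *v x)) * (y \<bullet> (A *v y))"
proof -
  let ?a = "x \<bullet> (A *v x)" and ?b = "x \<bullet> (A *v y)" and ?c = "y \<bullet> (A *v y)"
  have yx: "y \<bullet> (A *v x) = ?b" by (metis sym inner_commute)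
  have q: "0 \<le> s * s * ?a + 2 * s * t * ?b + t * t * ?c" for s t
  proof -
    have "(s *\<^sub>R x + t *\<^sub>R y) \<bullet> (A *v (s *\<^sub>R x + t *\<^sub>R y)) = s * s * ?a + 2 * s * t * ?b + t * t * ?c"
      by (simp add: matrix_vector_right_distrib matrix_vector_mult_scaleR inner_add yx algebra_simps)
    then show ?thesis using psd by metis
  qed
  show ?thesis
  proof (cases "?a = 0")
    case True
    have "?b = 0"
    proof (rule ccontr)
      assume "?b \<noteq> 0"
      \<comment> \<open>With \<open>?a = 0\<close> and \<open>t = 1\<close>, this \<open>s\<close>
        gives the quadratic the value -1.\<close>
      then show False using q[of "-(?c + 1) / (2 * ?b)" 1] True by (simp add: field_simps)
    qed
    then show ?thesis using True by simp
  next
    case False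
    then have a: "?a > 0" using psd[of x] by simp
    \<comment> \<open>At \<open>s = - ?b\<close>, \<open>t = ?a\<close> the quadratic factors in
      this way.\<close>
    have "0 \<le> ?a * (?a * ?c - ?b\<^sup>2)" using q[of "-?b" "?a"] by (simp add: algebra_simps power2_eq_square)
    then show ?thesis using a by (simp add: zero_le_mult_iff)
  qed
qed

text \<open>Cauchy-Schwarz for the pair \<open>A *v x\<close> and \<open>x\<close> bounds the fourth
  power of \<open>norm (A *v x)\<close> by a multiple of the vanishing form.\<close>

lemma psd_null_vector:
  fixes A :: "real^'n^'n"
  assumes sym: "\<And>x y. x \<bullet> (A *v y) = (A *v x) \<bullet> y"
    and psd: "\<And>x. 0 \<le> x \<bullet> (A *v x)"
    and "x \<bullet> (A *v x) = 0"
  shows "A *v x = 0"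
proof -
  have "((A *v x) \<bullet> (A *v x))\<^sup>2 \<le> 0"
    using psd_Cauchy_Schwarz[OF sym psd, of "A *v x" x] assms(3) by simp
  then show ?thesis by simp
qed

text \<open>Eigenvectors of distinct eigenvalues are orthogonal, hence independent, so only finitely
  many can be chosen.\<close>

lemma finite_eigenvalues:
  fixes A :: "real^'n^'n"
  assumes sym: "\<And>x y. x \<bullet> (A *v y) = (A *v x) \<bullet> y"
  shows "finite {c. eigenvalue A c}"
proof -
  have "\<forall>c\<in>{c. eigenvalue A c}. \<exists>v. v \<noteq> 0 \<and> A *v v = c *\<^sub>R v"
    by (auto simp: eigenvalue_def)
  then obtain w where w: "\<And>c. eigenvalue A c \<Longrightarrow> w c \<noteq> 0 \<and> A *v w c = c *\<^sub>R w c"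
    by (metis mem_Collect_eq)
  have orth: "w c \<bullet> w d = 0" if "eigenvalue A c" "eigenvalue A d" "c \<noteq> d" for c d
    using sym[of "w c" "w d"] w[OF that(1)] w[OF that(2)] that(3) by simp
  have inj: "inj_on w {c. eigenvalue A c}"
    by (rule inj_onI) (metis mem_Collect_eq orth inner_eq_zero_iff w)
  have "independent (w ` {c. eigenvalue A c})"
  proof (rule pairwise_orthogonal_independent)
    show "pairwise orthogonal (w ` {c. eigenvalue A c})"
      by (auto simp: pairwise_def orthogonal_def intro!: orth)
  qed (use w in auto)
  then have "finite (w ` {c. eigenvalue A c})" using independent_imp_finite by blast
  then show ?thesis using inj finite_imageD by blast
qed

text \<open>A minimiser of the Rayleigh quotient is an eigenvector.\<close>

lemma exists_eigenvalue:
  fixes A :: "real^'n^'n"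
  assumes sym: "\<And>x y. x \<bullet> (A *v y) = (A *v x) \<bullet> y"
  shows "\<exists>c. eigenvalue A c"
proof -
  let ?S = "sphere (0::real^'n) 1"
  obtain x where x: "x \<in> ?S" and min: "\<And>y. y \<in> ?S \<Longrightarrow> x \<bullet> (A *v x) \<le> y \<bullet> (A *v y)"
  proof -
    have "axis undefined 1 \<in> ?S" by simp
    then have ne: "?S \<noteq> {}" by blast
    have "continuous_on ?S (\<lambda>y. y \<bullet> (A *v y))"
      by (intro continuous_intros linear_continuous_on matrix_vector_mul_bounded_linear)
    from continuous_attains_inf[OF compact_sphere ne this] show thesis
      by (elim bexE) (rule that, assumption, elim ballE, assumption, simp)
  qed
  define c where "c = x \<bullet> (A *v x)"
  \<comment> \<open>Subtracting the minimum makes the form nonnegative with a zero at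
    \<open>x\<close>, so \<open>psd_null_vector\<close> replaces a Lagrange multiplier
    argument.\<close>
  define B where "B = A - c *\<^sub>R mat 1"
  have B: "B *v y = A *v y - c *\<^sub>R y" for y
    by (simp add: B_def matrix_vector_mult_diff_rdistrib scaleR_matrix_vector_assoc[symmetric])
  have psd: "0 \<le> y \<bullet> (B *v y)" for y
  proof (cases "y = 0")
    case False
    have "(1 / norm y) *\<^sub>R y \<in> ?S" using False by simp
    from min[OF this] have "c \<le> (1 / norm y) * ((1 / norm y) * (y \<bullet> (A *v y)))"
      by (simp add: c_def matrix_vector_mult_scaleR)
    then have "c * (norm y)\<^sup>2 \<le> y \<bullet> (A *v y)"
      using False by (simp add: field_simps power2_eq_square)
    then show ?thesis by (simp add: B inner_diff_right power2_norm_eq_inner)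
  qed simp
  have "x \<bullet> x = 1" using x by (simp add: norm_eq_1)
  then have "x \<bullet> (B *v x) = 0" by (simp add: B inner_diff_right c_def)
  moreover have "y \<bullet> (B *v z) = (B *v y) \<bullet> z" for y z
    by (simp add: B inner_diff_right inner_diff_left sym)
  ultimately have "B *v x = 0" using psd_null_vector psd by blast
  then have "A *v x = c *\<^sub>R x" by (simp add: B)
  moreover have "x \<noteq> 0" using \<open>x \<bullet> x = 1\<close> by auto
  ultimately show ?thesis by (auto simp: eigenvalue_def)
qed

text \<open>Evaluating the form at an eigenvector bounds each eigenvalue; as the set of eigenvalues
  is finite and nonempty, \<open>Min\<close> is a genuine minimum.\<close>

lemma smallest_eigenvalue_ge:
  fixes A :: "real^'n^'n"
  assumes sym: "\<And>x y. x \<bullet> (A *v y) = (A *v x) \<bullet> y"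
    and low: "\<And>v. \<alpha> * (norm v)\<^sup>2 \<le> v \<bullet> (A *v v)"
  shows "\<alpha> \<le> smallest_eigenvalue A"
proof -
  have "\<alpha> \<le> c" if "eigenvalue A c" for c
  proof -
    from that obtain v where v: "v \<noteq> 0" "A *v v = c *\<^sub>R v" by (auto simp: eigenvalue_def)
    have "\<alpha> * (norm v)\<^sup>2 \<le> c * (norm v)\<^sup>2" using low[of v] v by (simp add: power2_norm_eq_inner)
    then show ?thesis using v by simp
  qed
  then show ?thesis
    unfolding smallest_eigenvalue_def
    using finite_eigenvalues[OF sym] exists_eigenvalue[OF sym] by (subst Min_ge_iff) auto
qed

section \<open>Uniqueness of the Moore-Penrose inverse; determinants and symmetric sums\<close>

text \<open>Both \<open>A ** X\<close> and \<open>A ** Y\<close> are symmetric projections onto the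
  range of \<open>A\<close>, hence equal; likewise \<open>X ** A = Y ** A\<close>. Then
  \<open>Y = Y ** A ** Y\<close> turns into \<open>X ** A ** X = X\<close>.\<close>

lemma moore_penrose_inverse_eqI:
  assumes X: "is_moore_penrose_inverse A X"
  shows "moore_penrose_inverse A = X"
  unfolding moore_penrose_inverse_def
proof (rule the_equality[where P = "is_moore_penrose_inverse A", OF X])
  fix Y assume Y: "is_moore_penrose_inverse A Y"
  note XX = X[unfolded is_moore_penrose_inverse_def] and YY = Y[unfolded is_moore_penrose_inverse_def]
  have "A ** X = (A ** Y ** A) ** X" using YY by simp
  also have "\<dots> = (A ** Y) ** (A ** X)" by (simp add: matrix_mul_assoc)
  also have "\<dots> = transpose ((A ** X ** A) ** Y)"
    using XX YY by (metis matrix_transpose_mul matrix_mul_assoc)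
  finally have AXAY: "A ** X = A ** Y" using XX YY by simp
  have "X ** A = X ** (A ** Y ** A)" using YY by simp
  also have "\<dots> = (X ** A) ** (Y ** A)" by (simp add: matrix_mul_assoc)
  also have "\<dots> = transpose (Y ** (A ** X ** A))"
    using XX YY by (metis matrix_transpose_mul matrix_mul_assoc)
  finally have XAYA: "X ** A = Y ** A" using XX YY by simp
  have "Y = Y ** A ** Y" using YY by simp
  also have "\<dots> = X ** A ** Y" using XAYA by simp
  also have "\<dots> = X ** (A ** X)" using AXAY by (simp add: matrix_mul_assoc)
  also have "\<dots> = X" using XX by (simp add: matrix_mul_assoc)
  finally show "Y = X" .
qed

lemma continuous_on_det:
  fixes A :: "'a::topological_space \<Rightarrow> real^'n^'n"
  assumes "\<And>i j. continuous_on S (\<lambda>x. A x $ i $ j)"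
  shows "continuous_on S (\<lambda>x. det (A x))"
  unfolding det_def by (intro continuous_intros assms)

lemma sum_less_symmetric:
  fixes f :: "'v::{finite,linorder} \<Rightarrow> 'v \<Rightarrow> real"
  assumes "\<And>i j. f i j = f j i" "\<And>i. f i i = 0"
  shows "2 * (\<Sum>(i, j)\<in>{(i, j). i < j}. f i j) = (\<Sum>i\<in>UNIV. \<Sum>j\<in>UNIV. f i j)"
proof -
  let ?L = "{(i::'v, j). i < j}" and ?G = "{(i::'v, j). j < i}" and ?D = "{(i::'v, j). i = j}"
  have "(\<Sum>i\<in>UNIV. \<Sum>j\<in>UNIV. f i j) = (\<Sum>(i, j)\<in>UNIV. f i j)"
    by (simp add: sum.cartesian_product)
  also have "(UNIV :: ('v \<times> 'v) set) = ?L \<union> ?G \<union> ?D" by auto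
  also have "(\<Sum>(i, j)\<in>?L \<union> ?G \<union> ?D. f i j) = (\<Sum>(i, j)\<in>?L. f i j) + (\<Sum>(i, j)\<in>?G. f i j) + (\<Sum>(i, j)\<in>?D. f i j)"
    by (subst sum.union_disjoint; auto)+
  also have "(\<Sum>(i, j)\<in>?D. f i j) = 0" by (rule sum.neutral) (auto simp: assms)
  also have "(\<Sum>(i, j)\<in>?G. f i j) = (\<Sum>(i, j)\<in>?L. f i j)"
    by (rule sum.reindex_bij_witness[of _ "\<lambda>(i, j). (j, i)" "\<lambda>(i, j). (j, i)"]) (auto simp: assms)
  finally show ?thesis by simp
qed

section \<open>The positive definite matrix \<open>K\<close> and its inverse
  \<open>N\<close>\<close>

text \<open>Isolates what the matrix analysis uses of the graph; \<open>kernel_b\<close> is the form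
  that connectedness takes.\<close>

locale incidence_vectors =
  fixes b :: "'m::finite \<Rightarrow> real ^ 'v::finite"
  assumes sum_b: "1 \<bullet> b k = 0"
    and kernel_b: "(\<And>k. b k \<bullet> y = 0) \<Longrightarrow> \<exists>c. y = c *\<^sub>R 1"
begin

definition K :: "real ^ 'm \<Rightarrow> real ^ 'v ^ 'v" where
  "K x = (\<chi> s t. 1 / CARD('v) + (\<Sum>k\<in>UNIV. x $ k * b k $ s * b k $ t))"

definition N :: "real ^ 'm \<Rightarrow> real ^ 'v ^ 'v" where
  "N x = matrix_inv (K x)"

text \<open>Without the upper bound \<open>M\<close> the set of weights is open, so derivatives can
  be taken throughout it.\<close>

definition pos :: "(real ^ 'm) set" where
  "pos = {x. \<forall>k. 0 < x $ k}"

lemma open_pos: "open pos"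
proof -
  have "pos = (\<Inter>k. {x. 0 < x $ k})" by (auto simp: pos_def)
  also have "open \<dots>"
    by (intro open_INT ballI open_Collect_less continuous_intros) simp
  finally show ?thesis .
qed

lemma K_mult: "K x *v y = ((1 \<bullet> y) / CARD('v)) *\<^sub>R 1 + (\<Sum>k\<in>UNIV. (x $ k * (b k \<bullet> y)) *\<^sub>R b k)"
proof -
  have "(\<Sum>t\<in>UNIV. (\<Sum>k\<in>UNIV. x $ k * b k $ s * b k $ t) * y $ t)
      = (\<Sum>k\<in>UNIV. x $ k * (\<Sum>t\<in>UNIV. b k $ t * y $ t) * b k $ s)" for s
    unfolding sum_distrib_right sum_distrib_left
    by (subst sum.swap) (simp add: mult_ac)
  then show ?thesis
    by (simp add: vec_eq_iff K_def matrix_vector_mult_def inner_vec_def distrib_right sum.distrib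
        sum_divide_distrib)
qed

lemma K_sym: "u \<bullet> (K x *v y) = (K x *v u) \<bullet> y"
  by (simp add: K_mult inner_add_left inner_add_right inner_sum_left inner_sum_right inner_commute mult_ac)

lemma K_form: "y \<bullet> (K x *v y) = (1 \<bullet> y)\<^sup>2 / CARD('v) + (\<Sum>k\<in>UNIV. x $ k * (b k \<bullet> y)\<^sup>2)"
  by (simp add: K_mult inner_add_right inner_sum_right inner_commute power2_eq_square mult_ac)

lemma K_psd: "x \<in> pos \<Longrightarrow> 0 \<le> y \<bullet> (K x *v y)"
  unfolding K_form by (intro add_nonneg_nonneg sum_nonneg) (auto simp: pos_def less_imp_le)

text \<open>All terms of \<open>K_form\<close> are nonnegative, so each vanishes. The edge terms
  force \<open>y\<close> to be constant by \<open>kernel_b\<close>, and the first term makes the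
  constant zero.\<close>

lemma K_null:
  assumes x: "x \<in> pos" and "K x *v y = 0"
  shows "y = 0"
proof -
  have "(1 \<bullet> y)\<^sup>2 / CARD('v) + (\<Sum>k\<in>UNIV. x $ k * (b k \<bullet> y)\<^sup>2) = 0"
    using assms(2) K_form[of y x] by simp
  moreover have "0 \<le> (1 \<bullet> y)\<^sup>2 / CARD('v)" by simp
  moreover have nn: "0 \<le> x $ k * (b k \<bullet> y)\<^sup>2" for k using x by (simp add: pos_def less_imp_le)
  moreover have "0 \<le> (\<Sum>k\<in>UNIV. x $ k * (b k \<bullet> y)\<^sup>2)" using nn by (intro sum_nonneg) auto
  ultimately have 1: "(1 \<bullet> y)\<^sup>2 / CARD('v) = 0" and 2: "(\<Sum>k\<in>UNIV. x $ k * (b k \<bullet> y)\<^sup>2) = 0"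
    by linarith+
  from 2 nn have "x $ k * (b k \<bullet> y)\<^sup>2 = 0" for k
    by (simp add: sum_nonneg_eq_0_iff)
  then have "b k \<bullet> y = 0" for k using x by (simp add: pos_def less_le)
  then obtain c where c: "y = c *\<^sub>R 1" using kernel_b by blast
  have "(1::real^'v) \<bullet> 1 = CARD('v)" by (simp add: inner_vec_def)
  then show ?thesis using 1 c by simp
qed

lemma K_invertible: "x \<in> pos \<Longrightarrow> invertible (K x)"
  unfolding invertible_left_inverse matrix_left_invertible_injective
  by (rule injI) (metis K_null matrix_vector_mult_diff_distrib right_minus_eq)

lemma
  assumes "x \<in> pos"
  shows K_times_N: "K x ** N x = mat 1" and N_times_K: "N x ** K x = mat 1"
  using someI_ex[OF K_invertible[OF assms, unfolded invertible_def]] by (auto simp: N_def matrix_inv_def)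

lemma K_N: "x \<in> pos \<Longrightarrow> K x *v (N x *v y) = y"
  by (simp add: matrix_vector_mul_assoc K_times_N)

lemma N_K: "x \<in> pos \<Longrightarrow> N x *v (K x *v y) = y"
  by (simp add: matrix_vector_mul_assoc N_times_K)

lemma N_sym: "x \<in> pos \<Longrightarrow> u \<bullet> (N x *v y) = (N x *v u) \<bullet> y"
  by (metis K_N K_sym)

text \<open>Cramer's rule expresses the entries as quotients of determinants that are polynomial in
  the weights, with nonzero denominator.\<close>

lemma continuous_on_N: "continuous_on pos (\<lambda>x. N x *v u)"
proof -
  have eq: "N x *v u = (\<chi> k. det (\<chi> i j. if j = k then u $ i else K x $ i $ j) / det (K x))"
    if "x \<in> pos" for x
    using cramer[of "K x" "N x *v u" u] that K_N K_invertible invertible_det_nz by blast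
  have K: "continuous_on pos (\<lambda>x. K x $ i $ j)" for i j
    unfolding K_def by (simp, intro continuous_intros)
  have "continuous_on pos (\<lambda>x. if j = k then u $ i else K x $ i $ j)" for i j k
    using K by (cases "j = k") auto
  then have "continuous_on pos (\<lambda>x. \<chi> k. det (\<chi> i j. if j = k then u $ i else K x $ i $ j) / det (K x))"
    using K_invertible
    by (intro continuous_intros continuous_on_det K) (auto simp: invertible_det_nz)
  then show ?thesis by (simp add: eq cong: continuous_on_cong)
qed

section \<open>First and second derivatives of \<open>N\<close> and its trace\<close>

lemma K_diff: "K y *v z - K x *v z = (\<Sum>k\<in>UNIV. ((y $ k - x $ k) * (b k \<bullet> z)) *\<^sub>R b k)"
  by (simp add: K_mult sum_subtractf[symmetric] scaleR_left_diff_distrib[symmetric] left_diff_distrib)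

text \<open>The resolvent identity gives the difference quotients of \<^term>\<open>N\<close> exactly, so that its
  derivative only needs its continuity.\<close>

lemma has_derivative_N:
  assumes x: "x \<in> pos"
  shows "((\<lambda>y. N y *v u) has_derivative
    (\<lambda>h. - (\<Sum>k\<in>UNIV. h $ k *\<^sub>R ((b k \<bullet> (N x *v u)) *\<^sub>R (N x *v b k))))) (at x)"
proof -
  have eq: "N x *v u - (\<Sum>k\<in>UNIV. (y $ k - x $ k) *\<^sub>R ((b k \<bullet> (N x *v u)) *\<^sub>R (N y *v b k)))
      = N y *v u" if y: "y \<in> pos" for y
  proof -
    have "N y *v (K y *v (N x *v u) - K x *v (N x *v u)) = N x *v u - N y *v u"
      using x y by (simp add: matrix_vector_mult_diff_distrib N_K K_N)
    then have "N x *v u - N y *v u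
        = (\<Sum>k\<in>UNIV. (y $ k - x $ k) *\<^sub>R ((b k \<bullet> (N x *v u)) *\<^sub>R (N y *v b k)))"
      unfolding K_diff by (simp add: linear_sum[OF matrix_vector_mul_linear] matrix_vector_mult_scaleR)
    then show ?thesis by (simp add: algebra_simps)
  qed
  have cont: "isCont (\<lambda>y. N y *v u) x" for u
    using continuous_on_N open_pos x continuous_on_eq_continuous_at by blast
  \<comment> \<open>The factor \<open>y $ k - x $ k\<close> vanishes at \<open>x\<close>, so
    \<open>N y *v b k\<close> need only be continuous there.\<close>
  have "((\<lambda>y. (y $ k - x $ k) *\<^sub>R ((b k \<bullet> (N x *v u)) *\<^sub>R (N y *v b k))) has_derivative
      (\<lambda>h. h $ k *\<^sub>R ((b k \<bullet> (N x *v u)) *\<^sub>R (N x *v b k)))) (at x)" for k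
    by (rule has_derivative_vanishing_scaleR)
      (auto intro!: derivative_eq_intros cont continuous_intros bounded_linear_imp_has_derivative bounded_linear_vec_nth)
  then have "((\<lambda>y. N x *v u - (\<Sum>k\<in>UNIV. (y $ k - x $ k) *\<^sub>R ((b k \<bullet> (N x *v u)) *\<^sub>R (N y *v b k))))
      has_derivative (\<lambda>h. 0 - (\<Sum>k\<in>UNIV. h $ k *\<^sub>R ((b k \<bullet> (N x *v u)) *\<^sub>R (N x *v b k))))) (at x)"
    by (intro has_derivative_diff has_derivative_const has_derivative_sum)
  then have "((\<lambda>y. N x *v u - (\<Sum>k\<in>UNIV. (y $ k - x $ k) *\<^sub>R ((b k \<bullet> (N x *v u)) *\<^sub>R (N y *v b k))))
      has_derivative (\<lambda>h. - (\<Sum>k\<in>UNIV. h $ k *\<^sub>R ((b k \<bullet> (N x *v u)) *\<^sub>R (N x *v b k))))) (at x)"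
    by simp
  then show ?thesis
    by (rule has_derivative_transform_within_open[OF _ open_pos x eq])
qed

text \<open>The second partial derivatives of \<open>trace (N x)\<close>: the two orders of
  \<open>k\<close> and \<open>l\<close> in
  \<open>trace (N * b k * b k^T * N * b l * b l^T * N)\<close> contribute equally, whence the factor
  2.\<close>

definition hess :: "real ^ 'm \<Rightarrow> 'm \<Rightarrow> 'm \<Rightarrow> real" where
  "hess x k l = 2 * (b k \<bullet> (N x *v b l)) * ((N x *v b k) \<bullet> (N x *v b l))"

lemma hess_sym: "x \<in> pos \<Longrightarrow> hess x k l = hess x l k"
  unfolding hess_def using N_sym[of x "b k" "b l"] by (simp add: inner_commute)

lemma continuous_on_hess: "continuous_on pos (\<lambda>x. hess x k l)"
  unfolding hess_def by (intro continuous_intros continuous_on_N)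

text \<open>In direction \<open>k\<close> the derivative of \<open>N\<close> is
  \<open>- (N * b k) * (N * b k)^T\<close>, by symmetry of \<open>N\<close>; its trace is minus a
  squared norm.\<close>

lemma has_derivative_trace_N:
  assumes x: "x \<in> pos"
  shows "((\<lambda>y. trace (N y)) has_derivative (\<lambda>h. - (\<Sum>k\<in>UNIV. h $ k * (norm (N x *v b k))\<^sup>2))) (at x)"
proof -
  have tr: "trace A = (\<Sum>s\<in>UNIV. axis s 1 \<bullet> (A *v axis s 1))" for A :: "real^'v^'v"
    by (simp add: trace_def inner_axis' matrix_vector_mult_basis column_def)
  have "((\<lambda>y. trace (N y)) has_derivative (\<lambda>h. \<Sum>s\<in>UNIV. axis s 1 \<bullet>
      (- (\<Sum>k\<in>UNIV. h $ k *\<^sub>R ((b k \<bullet> (N x *v axis s 1)) *\<^sub>R (N x *v b k)))))) (at x)"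
    unfolding tr by (intro has_derivative_sum has_derivative_inner_right has_derivative_N x)
  moreover have "(\<Sum>s\<in>UNIV. axis s 1 \<bullet>
      (- (\<Sum>k\<in>UNIV. h $ k *\<^sub>R ((b k \<bullet> (N x *v axis s 1)) *\<^sub>R (N x *v b k)))))
      = - (\<Sum>k\<in>UNIV. h $ k * (norm (N x *v b k))\<^sup>2)" for h
  proof -
    have "(\<Sum>s\<in>UNIV. \<Sum>k\<in>UNIV. h $ k * (N x *v b k) $ s * (N x *v b k) $ s)
        = (\<Sum>k\<in>UNIV. h $ k * (norm (N x *v b k))\<^sup>2)"
      by (subst sum.swap) (simp add: sum_distrib_left power2_norm_eq_inner inner_vec_def mult_ac)
    then show ?thesis
      by (simp add: N_sym[OF x] inner_axis inner_axis' sum_negf)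
  qed
  ultimately show ?thesis by simp
qed

lemma has_derivative_grad:
  assumes x: "x \<in> pos"
  shows "((\<lambda>y. - (norm (N y *v b l))\<^sup>2) has_derivative (\<lambda>h. \<Sum>k\<in>UNIV. h $ k * hess x k l)) (at x)"
proof -
  have "((\<lambda>y. - ((N y *v b l) \<bullet> (N y *v b l))) has_derivative (\<lambda>h. -
     ((N x *v b l) \<bullet> (- (\<Sum>k\<in>UNIV. h $ k *\<^sub>R ((b k \<bullet> (N x *v b l)) *\<^sub>R (N x *v b k)))) +
      (- (\<Sum>k\<in>UNIV. h $ k *\<^sub>R ((b k \<bullet> (N x *v b l)) *\<^sub>R (N x *v b k)))) \<bullet> (N x *v b l)))) (at x)"
    by (intro has_derivative_minus has_derivative_inner has_derivative_N x)
  then show ?thesis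
    unfolding power2_norm_eq_inner
    by (rule has_derivative_eq_rhs)
      (simp add: fun_eq_iff inner_sum_left inner_sum_right hess_def sum_distrib_left sum_negf inner_commute mult_ac)
qed

section \<open>Lower bound for the Hessian form under bounded weights\<close>

text \<open>An eigenvalue bound for \<open>K x\<close>, uniform over weights at most
  \<open>M\<close>: the 1 accounts for \<open>J\<close>, the rest for the rank-one terms of
  \<open>L\<close>.\<close>

definition \<Lambda> :: "real \<Rightarrow> real" where
  "\<Lambda> M = 1 + M * (\<Sum>k\<in>UNIV. (norm (b k))\<^sup>2)"

lemma \<Lambda>_pos: "0 < M \<Longrightarrow> 0 < \<Lambda> M"
  unfolding \<Lambda>_def by (intro add_pos_nonneg mult_nonneg_nonneg sum_nonneg) auto

context
  fixes x :: "real ^ 'm" and M :: real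
  assumes M: "0 < M" and x: "\<And>k. 0 < x $ k" "\<And>k. x $ k \<le> M"
begin

lemma x_pos: "x \<in> pos" using x by (simp add: pos_def)

lemma K_upper: "y \<bullet> (K x *v y) \<le> \<Lambda> M * (norm y)\<^sup>2"
proof -
  have CS: "(a \<bullet> y)\<^sup>2 \<le> (norm a)\<^sup>2 * (norm y)\<^sup>2" for a :: "real^'v"
    using Cauchy_Schwarz_ineq[of a y] by (simp add: power2_norm_eq_inner)
  have "(norm (1::real^'v))\<^sup>2 = CARD('v)" by (simp add: power2_norm_eq_inner inner_vec_def)
  with CS[of 1] have "(1 \<bullet> y)\<^sup>2 / CARD('v) \<le> (norm y)\<^sup>2" by (simp add: field_simps)
  moreover have "(\<Sum>k\<in>UNIV. x $ k * (b k \<bullet> y)\<^sup>2) \<le> (\<Sum>k\<in>UNIV. M * ((norm (b k))\<^sup>2 * (norm y)\<^sup>2))"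
    using x M by (intro sum_mono mult_mono CS) auto
  ultimately show ?thesis
    unfolding K_form \<Lambda>_def by (simp add: distrib_left sum_distrib_left mult_ac)
qed

text \<open>In the matrix order this says \<open>K * K\<close> is at most
  \<open>\<Lambda> M * K\<close>. Cauchy-Schwarz in the form of \<open>K\<close>, applied to
  \<open>K x *v y\<close> and \<open>y\<close>, gives it without diagonalising.\<close>

lemma K_norm: "(norm (K x *v y))\<^sup>2 \<le> \<Lambda> M * (y \<bullet> (K x *v y))"
proof -
  let ?z = "K x *v y"
  have "(?z \<bullet> (K x *v y))\<^sup>2 \<le> (?z \<bullet> (K x *v ?z)) * (y \<bullet> (K x *v y))"
    by (intro psd_Cauchy_Schwarz K_sym K_psd x_pos)
  also have "\<dots> \<le> (\<Lambda> M * (norm ?z)\<^sup>2) * (y \<bullet> (K x *v y))"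
    by (intro mult_right_mono K_upper K_psd x_pos)
  finally have *: "(norm ?z)\<^sup>2 * (norm ?z)\<^sup>2 \<le> (norm ?z)\<^sup>2 * (\<Lambda> M * (y \<bullet> (K x *v y)))"
    unfolding power2_norm_eq_inner by (simp add: power2_eq_square mult_ac)
  show ?thesis
  proof (cases "norm ?z = 0")
    case False
    then have "0 < (norm ?z)\<^sup>2" by simp
    with * show ?thesis by (simp only: mult_le_cancel_left_pos)
  qed simp
qed

lemma N_form_ge: "(norm z)\<^sup>2 / \<Lambda> M \<le> z \<bullet> (N x *v z)"
  using K_norm[of "N x *v z"] \<Lambda>_pos[OF M] by (simp add: K_N x_pos inner_commute field_simps)

lemma N_norm_ge: "(norm z)\<^sup>2 / (\<Lambda> M)\<^sup>2 \<le> (norm (N x *v z))\<^sup>2"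
proof -
  have "(norm z)\<^sup>2 \<le> \<Lambda> M * ((N x *v z) \<bullet> (K x *v (N x *v z)))"
    using K_norm[of "N x *v z"] by (simp add: K_N x_pos)
  also have "\<dots> \<le> \<Lambda> M * (\<Lambda> M * (norm (N x *v z))\<^sup>2)"
    using \<Lambda>_pos[OF M] by (intro mult_left_mono K_upper) auto
  finally show ?thesis using \<Lambda>_pos[OF M] by (simp add: field_simps power2_eq_square)
qed

text \<open>With \<open>B = (\<Sum>k. v k * b k * b k\<^sup>T)\<close>, the sum on the left is the squared Frobenius norm
  of \<open>B\<close>, and the right-hand side is \<open>2 * trace (N B N B N)\<close>.\<close>

lemma hess_form_ge:
  "2 / \<Lambda> M ^ 3 * (\<Sum>s\<in>UNIV. (norm (\<Sum>k\<in>UNIV. (v k * b k $ s) *\<^sub>R b k))\<^sup>2)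
    \<le> (\<Sum>k\<in>UNIV. \<Sum>l\<in>UNIV. v k * v l * hess x k l)"
proof -
  define w where "w k = N x *v b k" for k
  \<comment> \<open>\<open>p s\<close> and \<open>r s\<close> are the columns of \<open>B N\<close>
    and \<open>B\<close>, and \<open>w k\<close> is \<open>N * b k\<close>.\<close>
  define p where "p s = (\<Sum>k\<in>UNIV. (v k * w k $ s) *\<^sub>R b k)" for s
  define r where "r s = (\<Sum>k\<in>UNIV. (v k * b k $ s) *\<^sub>R b k)" for s
  have h: "hess x k l = 2 * (b l \<bullet> w k) * (w k \<bullet> w l)" for k l
    using hess_sym[OF x_pos, of k l] by (simp add: hess_def w_def inner_commute)
  have Np: "N x *v p s = (\<Sum>k\<in>UNIV. (v k * w k $ s) *\<^sub>R w k)" for s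
    by (simp add: p_def w_def linear_sum[OF matrix_vector_mul_linear] matrix_vector_mult_scaleR)
  have "(\<Sum>s\<in>UNIV. p s \<bullet> (N x *v p s))
      = (\<Sum>s\<in>UNIV. \<Sum>k\<in>UNIV. \<Sum>l\<in>UNIV. v k * v l * (b l \<bullet> w k) * (w k $ s * w l $ s))"
    unfolding Np by (simp add: p_def inner_sum_left inner_sum_right mult_ac sum_distrib_left)
  also have "\<dots> = (\<Sum>k\<in>UNIV. \<Sum>s\<in>UNIV. \<Sum>l\<in>UNIV. v k * v l * (b l \<bullet> w k) * (w k $ s * w l $ s))"
    by (rule sum.swap)
  also have "\<dots> = (\<Sum>k\<in>UNIV. \<Sum>l\<in>UNIV. \<Sum>s\<in>UNIV. v k * v l * (b l \<bullet> w k) * (w k $ s * w l $ s))"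
    by (intro sum.cong[OF refl] sum.swap)
  also have "\<dots> = (\<Sum>k\<in>UNIV. \<Sum>l\<in>UNIV. v k * v l * (b l \<bullet> w k) * (w k \<bullet> w l))"
    by (simp add: inner_vec_def sum_distrib_left)
  finally have form: "(\<Sum>k\<in>UNIV. \<Sum>l\<in>UNIV. v k * v l * hess x k l) = 2 * (\<Sum>s\<in>UNIV. p s \<bullet> (N x *v p s))"
    by (simp add: h sum_distrib_left mult_ac)
  have Nr: "N x *v r t = (\<Sum>k\<in>UNIV. (v k * b k $ t) *\<^sub>R w k)" for t
    by (simp add: r_def w_def linear_sum[OF matrix_vector_mul_linear] matrix_vector_mult_scaleR)
  \<comment> \<open>\<open>B N\<close> and \<open>N B\<close> are transposes of each other, so their
    Frobenius norms agree, and the columns of \<open>N B\<close> are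
    \<open>N x *v r t\<close>.\<close>
  have "(\<Sum>s\<in>UNIV. (norm (p s))\<^sup>2) = (\<Sum>s\<in>UNIV. \<Sum>t\<in>UNIV. (p s $ t)\<^sup>2)"
    by (simp add: norm_vec_def L2_set_def sum_nonneg)
  also have "\<dots> = (\<Sum>t\<in>UNIV. \<Sum>s\<in>UNIV. ((N x *v r t) $ s)\<^sup>2)"
    unfolding Nr p_def by (subst sum.swap) (simp add: mult_ac)
  also have "\<dots> = (\<Sum>t\<in>UNIV. (norm (N x *v r t))\<^sup>2)"
    by (simp add: norm_vec_def L2_set_def sum_nonneg)
  finally have pr: "(\<Sum>s\<in>UNIV. (norm (p s))\<^sup>2) = (\<Sum>t\<in>UNIV. (norm (N x *v r t))\<^sup>2)" .
  \<comment> \<open>Two factors of \<open>\<Lambda> M\<close> are spent on \<open>N_norm_ge\<close>,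
    the third on \<open>N_form_ge\<close>.\<close>
  have "(\<Sum>s\<in>UNIV. (norm (r s))\<^sup>2) / \<Lambda> M ^ 3 = (\<Sum>t\<in>UNIV. (norm (r t))\<^sup>2 / (\<Lambda> M)\<^sup>2) / \<Lambda> M"
    by (simp add: sum_divide_distrib power2_eq_square power3_eq_cube mult_ac)
  also have "\<dots> \<le> (\<Sum>s\<in>UNIV. (norm (p s))\<^sup>2) / \<Lambda> M"
    unfolding pr using \<Lambda>_pos[OF M] by (intro divide_right_mono sum_mono N_norm_ge) auto
  also have "\<dots> \<le> (\<Sum>s\<in>UNIV. p s \<bullet> (N x *v p s))"
    unfolding sum_divide_distrib by (intro sum_mono N_form_ge)
  finally show ?thesis unfolding form r_def by simp
qed

end

section \<open>The pseudoinverse of \<open>L\<close> and the sum of resistances\<close>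

definition J :: "real ^ 'v ^ 'v" where
  "J = (\<chi> s t. 1 / CARD('v))"

lemma J_mult: "J *v y = ((1 \<bullet> y) / CARD('v)) *\<^sub>R 1"
  by (simp add: vec_eq_iff J_def matrix_vector_mult_def inner_vec_def sum_divide_distrib)

lemma inner_1_1: "(1::real^'v) \<bullet> 1 = CARD('v)"
  by (simp add: inner_vec_def)

text \<open>\<open>L\<close> annihilates the constants and \<open>J\<close> fixes them.\<close>

lemma K_1: "K x *v 1 = 1"
  using sum_b by (simp add: K_mult inner_1_1 inner_commute)

lemma J_J: "J ** J = J"
  by (simp add: matrix_eq matrix_vector_mul_assoc[symmetric] J_mult inner_1_1)

lemma K_J: "K x ** J = J"
  by (simp add: matrix_eq matrix_vector_mul_assoc[symmetric] J_mult matrix_vector_mult_scaleR K_1)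

lemma J_K: "J ** K x = J"
  by (simp add: matrix_eq matrix_vector_mul_assoc[symmetric] J_mult K_sym K_1)

lemma N_J: "x \<in> pos \<Longrightarrow> N x ** J = J"
  by (metis K_J N_times_K matrix_mul_assoc matrix_mul_lid)

lemma J_N: "x \<in> pos \<Longrightarrow> J ** N x = J"
  by (metis J_K K_times_N matrix_mul_assoc matrix_mul_rid)

text \<open>Both products of \<open>K x - J\<close> and \<open>N x - J\<close> are the symmetric
  projection \<open>mat 1 - J\<close>, from which the Penrose equations follow.\<close>

lemma moore_penrose_inverse_K_minus_J:
  assumes x: "x \<in> pos"
  shows "moore_penrose_inverse (K x - J) = N x - J"
proof (rule moore_penrose_inverse_eqI)
  have sub: "(A - B) ** C = A ** C - B ** C" "A ** (B - C) = A ** B - A ** C"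
    for A B C :: "real^'v^'v"
    by (simp_all add: matrix_eq matrix_vector_mul_assoc[symmetric] matrix_vector_mult_diff_distrib
        matrix_vector_mult_diff_rdistrib)
  have "(K x - J) ** (N x - J) = mat 1 - J" "(N x - J) ** (K x - J) = mat 1 - J"
    by (simp_all add: sub K_times_N N_times_K K_J J_K N_J J_N J_J x)
  moreover have "transpose (mat 1 - J) = mat 1 - J"
    by (simp add: vec_eq_iff transpose_def mat_def J_def)
  ultimately show "is_moore_penrose_inverse (K x - J) (N x - J)"
    by (simp add: is_moore_penrose_inverse_def sub J_K J_N J_J x)
qed

text \<open>The rows of \<open>X\<close> sum to zero, so the cross terms cancel and only multiples
  of \<open>trace X\<close> remain.\<close>

lemma sum_resistances:
  assumes x: "x \<in> pos" and X: "X = N x - J"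
  shows "(\<Sum>i\<in>UNIV. \<Sum>j\<in>UNIV. X $ i $ i + X $ j $ j - 2 * X $ i $ j) = 2 * CARD('v) * (trace (N x) - 1)"
proof -
  have "N x *v 1 = 1" using N_K[OF x, of 1] by (simp add: K_1)
  then have "X *v 1 = 0"
    by (simp add: X matrix_vector_mult_diff_rdistrib J_mult inner_1_1)
  then have row: "(\<Sum>j\<in>UNIV. X $ i $ j) = 0" for i
    by (simp add: vec_eq_iff matrix_vector_mult_def)
  have "trace J = 1" by (simp add: trace_def J_def)
  then have tr: "(\<Sum>i\<in>UNIV. X $ i $ i) = trace (N x) - 1"
    by (simp add: X trace_def sum_subtractf)
  show ?thesis
    by (simp add: sum.distrib sum_subtractf sum_distrib_left[symmetric] row tr)
qed

lemma N_transpose: "x \<in> pos \<Longrightarrow> N x $ i $ j = N x $ j $ i"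
  using N_sym[of x "axis i 1" "axis j 1"]
  by (simp add: inner_axis inner_axis' matrix_vector_mult_basis column_def)

end

section \<open>From the graph to strong convexity\<close>

theorem theorem3p7:
  fixes E :: "'v::{finite,linorder} set set"
    and e :: "'m::finite \<Rightarrow> 'v set"
    and M :: real
  assumes "simple_graph E"
    and "connected_graph E"
    and "CARD('v) \<ge> 2"
    and "bij_betw e UNIV E"
    and "M > 0"
  shows "strongly_convex_on {x :: real ^ 'm. \<forall>k. 0 < x $ k \<and> x $ k \<le> M} (kirchhoff_index e)"
proof -
  have inj: "inj e" and ran: "range e = E" using assms(4) by (auto simp: bij_betw_def)
  have "\<forall>k. \<exists>s t. e k = {s, t} \<and> s \<noteq> t"
    using assms(1) ran unfolding simple_graph_def card_2_iff by blast
  then obtain src tgt where ends: "\<And>k. e k = {src k, tgt k}" "\<And>k. src k \<noteq> tgt k"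
    by metis
  \<comment> \<open>The orientation is arbitrary: swapping the ends leaves
    \<open>b k * b k^T\<close>, and so \<open>K\<close>, unchanged.\<close>
  define b :: "'m \<Rightarrow> (real, 'v) vec" where "b k = axis (src k) 1 - axis (tgt k) 1" for k
  \<comment> \<open>Identifies the off-diagonal entries of \<open>L\<close>, and later recovers each
    \<open>v $ j\<close> from an entry of \<open>B\<close>.\<close>
  have b_off: "b k $ s * b k $ t = - (if {s, t} = e k then 1 else 0)" if "s \<noteq> t" for k s t
    using that ends[of k] by (auto simp: b_def axis_def doubleton_eq_iff)
  interpret incidence_vectors b
  proof
    show "1 \<bullet> b k = 0" for k by (simp add: b_def inner_diff_right inner_axis)
    fix y :: "(real, 'v) vec" assume 0: "\<And>k. b k \<bullet> y = 0"
    have step: "y $ s = y $ t" if "{s, t} \<in> E" for s t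
    proof -
      from that obtain k where "{s, t} = e k" using ran by blast
      then show ?thesis
        using 0[of k] ends[of k] by (auto simp: b_def inner_diff_left inner_axis' doubleton_eq_iff)
    qed
    have "y $ s = y $ t" if "(s, t) \<in> {(a, b). {a, b} \<in> E}\<^sup>*" for s t
      using that by (induction rule: rtrancl_induct) (auto dest: step)
    then have "y = (y $ undefined) *\<^sub>R 1"
      using assms(2) by (simp add: vec_eq_iff connected_graph_def)
    then show "\<exists>c. y = c *\<^sub>R 1" ..
  qed
  have adj: "adjacency_matrix e x $ s $ t = (\<Sum>k\<in>UNIV. x $ k * (if {s, t} = e k then 1 else 0))" for x s t
  proof (cases "\<exists>k. {s, t} = e k")
    case True
    then obtain j where j: "{s, t} = e j" by blast
    have eq: "{s, t} = e k \<longleftrightarrow> k = j" for k using inj j by (auto simp: inj_eq)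
    show ?thesis unfolding adjacency_matrix_def by (simp add: eq if_distrib[of "\<lambda>z. _ * z"] cong: if_cong)
  qed (simp add: adjacency_matrix_def)
  have lap: "laplacian e x = K x - J" for x
  proof -
    have "laplacian e x $ s $ t = (\<Sum>k\<in>UNIV. x $ k * b k $ s * b k $ t)" for s t
    proof (cases "s = t")
      case False
      then show ?thesis
        by (simp add: laplacian_def degree_matrix_def adj mult.assoc b_off sum_negf)
    next
      case True
      have diag: "adjacency_matrix e x $ s $ s = 0"
        using ends by (auto simp: adj doubleton_eq_iff intro!: sum.neutral) metis
      \<comment> \<open>Since \<open>b k\<close> sums to zero, its squared entry at \<open>s\<close>
        expands into the off-diagonal products that make up the degree.\<close>
      have "b k $ s = - (\<Sum>u\<in>UNIV-{s}. b k $ u)" for k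
        using sum_b[of k] by (simp add: inner_vec_def sum.remove[of UNIV s])
      then have "(\<Sum>k\<in>UNIV. x $ k * b k $ s * b k $ s)
          = (\<Sum>k\<in>UNIV. \<Sum>u\<in>UNIV-{s}. - (x $ k * (b k $ s * b k $ u)))"
        by (simp add: sum_distrib_left sum_negf mult_ac)
      also have "\<dots> = (\<Sum>u\<in>UNIV-{s}. \<Sum>k\<in>UNIV. - (x $ k * (b k $ s * b k $ u)))"
        by (rule sum.swap)
      also have "\<dots> = (\<Sum>u\<in>UNIV-{s}. adjacency_matrix e x $ s $ u)"
        by (intro sum.cong) (auto simp: adj b_off)
      finally show ?thesis
        using True diag by (simp add: laplacian_def degree_matrix_def sum.remove[of UNIV s])
    qed
    then show ?thesis by (simp add: vec_eq_iff K_def J_def)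
  qed
  let ?n = "real CARD('v)" and ?f = "kirchhoff_index e"
  have Kf: "?n * (trace (N x) - 1) = ?f x" if x: "x \<in> pos" for x
  proof -
    define X where "X = N x - J"
    have X: "moore_penrose_inverse (laplacian e x) = X"
      unfolding lap X_def by (rule moore_penrose_inverse_K_minus_J[OF x])
    have "2 * ?f x = (\<Sum>i\<in>UNIV. \<Sum>j\<in>UNIV. X $ i $ i + X $ j $ j - 2 * X $ i $ j)"
      unfolding kirchhoff_index_def resistance_distance_def X Let_def
      by (rule sum_less_symmetric) (simp_all add: X_def J_def N_transpose[OF x])
    then show ?thesis unfolding sum_resistances[OF x X_def] by simp
  qed
  have f': "(?f has_derivative (\<lambda>h. ?n * (- (\<Sum>k\<in>UNIV. h $ k * (norm (N x *v b k))\<^sup>2)))) (at x)"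
    if x: "x \<in> pos" for x
  proof -
    have "((\<lambda>x. ?n * (trace (N x) - 1)) has_derivative
        (\<lambda>h. ?n * (- (\<Sum>k\<in>UNIV. h $ k * (norm (N x *v b k))\<^sup>2) - 0))) (at x)"
      by (intro has_derivative_mult_right has_derivative_diff has_derivative_const
          has_derivative_trace_N x)
    from has_derivative_transform_within_open[OF this open_pos x Kf] show ?thesis by simp
  qed
  have axis_sum: "(\<Sum>k\<in>UNIV. axis l 1 $ k * g k) = g l" for l :: 'm and g :: "'m \<Rightarrow> real"
    by (simp add: axis_def if_distrib[of "\<lambda>z. z * _"] cong: if_cong)
  have p1: "?n * (- (norm (N x *v b l))\<^sup>2) = partial_deriv l ?f x" if x: "x \<in> pos" for x l
    using partial_deriv_eq[OF f'[OF x], of l] by (simp add: axis_sum)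
  have f'': "(partial_deriv l ?f has_derivative (\<lambda>h. ?n * (\<Sum>k\<in>UNIV. h $ k * hess x k l))) (at x)"
    if x: "x \<in> pos" for x l
  proof -
    have "((\<lambda>x. ?n * (- (norm (N x *v b l))\<^sup>2)) has_derivative
        (\<lambda>h. ?n * (\<Sum>k\<in>UNIV. h $ k * hess x k l))) (at x)"
      by (intro has_derivative_mult_right has_derivative_grad x)
    from has_derivative_transform_within_open[OF this open_pos x p1] show ?thesis .
  qed
  have p2: "partial_deriv k (partial_deriv l ?f) x = ?n * hess x k l" if x: "x \<in> pos" for x k l
    using partial_deriv_eq[OF f''[OF x], of k] by (simp add: axis_sum)
  let ?S = "{x :: real ^ 'm. \<forall>k. 0 < x $ k \<and> x $ k \<le> M}"
  have "convex ?S"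
  proof -
    have "?S = (\<Inter>k. {x. x $ k \<in> {0<..M}})" by auto
    also have "convex \<dots>"
      using convex_linear_vimage[OF bounded_linear.linear[OF bounded_linear_vec_nth], of "{0<..M}"]
      by (intro convex_INT) (simp add: vimage_def convex_real_interval)
    finally show ?thesis .
  qed
  moreover have "twice_continuously_differentiable_on ?f pos"
    unfolding twice_continuously_differentiable_on_def
  proof (intro conjI allI ballI)
    show "continuous_on pos (partial_deriv k (partial_deriv l ?f))" for k l
    proof -
      have "continuous_on pos (\<lambda>x. ?n * hess x k l)"
        by (intro continuous_intros continuous_on_hess)
      then show ?thesis by (simp add: p2 cong: continuous_on_cong)
    qed
  qed (use f' f'' in \<open>auto simp: differentiable_def\<close>)
  moreover have "?S \<subseteq> pos" by (auto simp: pos_def)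
  moreover have "2 * ?n / \<Lambda> M ^ 3 \<le> smallest_eigenvalue (hessian ?f x)" if x: "x \<in> ?S" for x
  proof (rule smallest_eigenvalue_ge)
    have xp: "x \<in> pos" using x by (auto simp: pos_def)
    have H: "hessian ?f x = (\<chi> k l. ?n * hess x k l)"
      by (simp add: hessian_def p2[OF xp])
    have form: "u \<bullet> (hessian ?f x *v v) = ?n * (\<Sum>k\<in>UNIV. \<Sum>l\<in>UNIV. u $ k * v $ l * hess x k l)" for u v
      by (simp add: H inner_vec_def matrix_vector_mult_def sum_distrib_left mult_ac)
    show "u \<bullet> (hessian ?f x *v v) = (hessian ?f x *v u) \<bullet> v" for u v
    proof -
      have "(\<Sum>k\<in>UNIV. \<Sum>l\<in>UNIV. u $ k * v $ l * hess x k l) = (\<Sum>l\<in>UNIV. \<Sum>k\<in>UNIV. v $ l * u $ k * hess x l k)"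
        using hess_sym[OF xp] by (subst sum.swap) (simp add: mult.commute)
      then show ?thesis by (simp only: form inner_commute[of "_ *v _"])
    qed
    show "2 * ?n / \<Lambda> M ^ 3 * (norm v)\<^sup>2 \<le> v \<bullet> (hessian ?f x *v v)" for v
    proof -
      \<comment> \<open>The entries of the matrix \<open>B\<close> from
        \<open>hess_form_ge\<close>.\<close>
      define c where "c s t = (\<Sum>k\<in>UNIV. v $ k * b k $ s * b k $ t)" for s t
      have off: "c (src j) (tgt j) = - v $ j" for j
      proof -
        \<comment> \<open>As \<open>e\<close> is injective, no other edge contributes to this
          entry.\<close>
        have eq: "{src j, tgt j} = e k \<longleftrightarrow> k = j" for k using inj ends by (metis injD)
        show ?thesis by (simp add: c_def mult.assoc b_off ends(2) eq sum_negf if_distrib[of "\<lambda>z. _ * z"] cong: if_cong)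
      qed
      \<comment> \<open>Different edges occupy different positions of \<open>B\<close>, so the
        squares of the \<open>v $ k\<close> form part of its squared Frobenius norm.\<close>
      have inj': "inj (\<lambda>k. (src k, tgt k))"
        by (rule injI) (metis Pair_inject ends(1) inj injD)
      have "(norm v)\<^sup>2 = (\<Sum>k\<in>UNIV. (c (src k) (tgt k))\<^sup>2)"
        by (simp add: off norm_vec_def L2_set_def sum_nonneg)
      also have "\<dots> = (\<Sum>(s, t)\<in>range (\<lambda>k. (src k, tgt k)). (c s t)\<^sup>2)"
        by (simp add: sum.reindex[OF inj'])
      also have "\<dots> \<le> (\<Sum>(s, t)\<in>UNIV. (c s t)\<^sup>2)"
        by (rule sum_mono2) auto
      also have "\<dots> = (\<Sum>s\<in>UNIV. \<Sum>t\<in>UNIV. (c s t)\<^sup>2)"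
        by (simp add: sum.cartesian_product)
      also have "\<dots> = (\<Sum>s\<in>UNIV. (norm (\<Sum>k\<in>UNIV. (v $ k * b k $ s) *\<^sub>R b k))\<^sup>2)"
        by (simp add: c_def norm_vec_def L2_set_def sum_nonneg)
      finally have "2 / \<Lambda> M ^ 3 * (norm v)\<^sup>2 \<le> 2 / \<Lambda> M ^ 3 * \<dots>"
        using \<Lambda>_pos[OF assms(5)] by (intro mult_left_mono) auto
      also have "\<dots> \<le> (\<Sum>k\<in>UNIV. \<Sum>l\<in>UNIV. v $ k * v $ l * hess x k l)"
        using x by (intro hess_form_ge assms(5)) auto
      finally have "?n * (2 / \<Lambda> M ^ 3 * (norm v)\<^sup>2) \<le> v \<bullet> (hessian ?f x *v v)"
        unfolding form by (rule mult_left_mono) simp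
      then show ?thesis by (simp add: mult_ac)
    qed
  qed
  moreover have "0 < 2 * ?n / \<Lambda> M ^ 3"
    using \<Lambda>_pos[OF assms(5)] by simp
  ultimately show ?thesis
    unfolding strongly_convex_on_def using open_pos by blast
qed

end
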